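(* Let $m\ge 2$, let $p\in\mathbb{R}_{>0}^n$ and let $f:\mathbb{D}\to\mathcal{E}(p)$ be of the form $(\ast_m)$ (defined in the context), with parameters $a_j,\alpha_{kj},\alpha_{k0},r_{kj}$. Assume that (a) $p_1,\ldots,p_n\ge 1/2$, (b) $q\in\mathcal{S}_n$, (c) $\alpha_{kj}\in\mathbb{D}$ and $r_{kj}=0$ for $k=1,\ldots,m-1$ and $j\in J$, where $J:=\{j:p_j/q_j\notin\mathbb{N}\}$, (d) $s_j:=\#\{k:r_{kj}=1\}$, (e) $\widetilde m:=m+\sum_{j\notin J}(p_j/q_j-1)s_j$. Then $f$ is an $\widetilde m$-extremal. In particular, $f$ is an $\bigl(m+(m-1)(p_1/q_1+\ldots+p_n/q_n-n)\bigr)$-extremal, provided that $q\in\mathcal{S}_n$ and $p_j/q_j\in\mathbb{N}$, $j=1,\ldots,n$.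
   Context: $\mathbb{D}$ is the open unit disc in $\mathbb{C}$ and $\mathbb{N}=\{1,2,\ldots\}$. For $p\in\mathbb{R}_{>0}^n$, $\mathcal{E}(p)=\{z\in\mathbb{C}^n:|z_1|^{2p_1}+\ldots+|z_n|^{2p_n}<1\}$. The set $\mathcal{S}_n\subset[1/2,\infty)^n$ is the smallest set such that: $(1/2,\ldots,1/2)\in\mathcal{S}_n$; if $p\in\mathcal{S}_n$ and $c\ge 1$ then $cp\in\mathcal{S}_n$; if $p\in\mathcal{S}_n$ then $(p_1,\ldots,p_{j-1},1,p_{j+1},\ldots,p_n)\in\mathcal{S}_n$ for any $j$. For a domain $D\subset\mathbb{C}^n$ and an integer $l\ge 2$, a holomorphic mapping $f:\mathbb{D}\to D$ is an $l$-extremal if for every choice of pairwise distinct $\lambda_1,\ldots,\lambda_l\in\mathbb{D}$ there is no mapping $h$, holomorphic in a neighborhood of $\overline{\mathbb{D}}$ with values in $D$, such that $h(\lambda_j)=f(\lambda_j)$, $j=1,\ldots,l$. A map $f=(f_1,\ldots,f_n):\mathbb{D}\to\mathcal{E}(p)$ is of the form $(\ast_m)$ if $$f_j(\lambda)=a_j\prod_{k=1}^{m-1}\left(\frac{\lambda-\alpha_{kj}}{1-\overline{\alpha}_{kj}\lambda}\right)^{r_{kj}}\left(\frac{1-\overline{\alpha}_{kj}\lambda}{1-\overline{\alpha}_{k0}\lambda}\right)^{1/p_j},\quad j=1,\ldots,n,$$ where $a_j\in\mathbb{C}\setminus\{0\}$, $\alpha_{kj}\in\overline{\mathbb{D}}$,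 $\alpha_{k0}\in\mathbb{D}$, $r_{kj}\in\{0,1\}$, $$\sum_{j=1}^n|a_j|^{2p_j}\prod_{k=1}^{m-1}(\lambda-\alpha_{kj})(1-\overline{\alpha}_{kj}\lambda)=\prod_{k=1}^{m-1}(\lambda-\alpha_{k0})(1-\overline{\alpha}_{k0}\lambda),\quad\lambda\in\mathbb{C},$$ and $f$ is not constant. Here the powers $(\cdot)^{1/p_j}$ denote the holomorphic branch on $\mathbb{D}$ equal to $1$ at $\lambda=0$, and for $|\alpha_{kj}|=1$ the factor $\frac{\lambda-\alpha_{kj}}{1-\overline{\alpha}_{kj}\lambda}$ is understood as the unimodular constant $-\alpha_{kj}$. *)

theory Defs
  imports "HOL-Complex_Analysis.Complex_Analysis"
begin

definition cellipsoid :: "real ^ 'n \<Rightarrow> (complex ^ 'n) set" where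
  "cellipsoid p = {z. (\<Sum>j\<in>UNIV. cmod (z $ j) powr (2 * p $ j)) < 1}"

inductive_set S_set :: "(real ^ 'n) set" where
  half: "(\<chi> i. 1/2) \<in> S_set"
| scale: "p \<in> S_set \<Longrightarrow> c \<ge> 1 \<Longrightarrow> c *\<^sub>R p \<in> S_set"
| replace: "p \<in> S_set \<Longrightarrow> (\<chi> i. if i = j then 1 else p $ i) \<in> S_set"

definition holomorphic_map_on :: "(complex \<Rightarrow> complex ^ 'n) \<Rightarrow> complex set \<Rightarrow> bool" where
  "holomorphic_map_on f U \<longleftrightarrow> (\<forall>j. (\<lambda>z. f z $ j) holomorphic_on U)"

definition l_extremal :: "(complex ^ 'n) set \<Rightarrow> nat \<Rightarrow> (complex \<Rightarrow> complex ^ 'n) \<Rightarrow> bool" where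
  "l_extremal D l f \<longleftrightarrow>
     l \<ge> 2 \<and> holomorphic_map_on f (ball 0 1) \<and> f ` ball 0 1 \<subseteq> D \<and>
     (\<forall>\<mu> :: nat \<Rightarrow> complex. \<mu> ` {1..l} \<subseteq> ball 0 1 \<and> inj_on \<mu> {1..l} \<longrightarrow>
        \<not> (\<exists>h U. open U \<and> cball 0 1 \<subseteq> U \<and> holomorphic_map_on h U \<and> h ` U \<subseteq> D \<and>
               (\<forall>j\<in>{1..l}. h (\<mu> j) = f (\<mu> j))))"

text \<open>
  The parameters are indexed by \<open>k \<in> {1..m-1}\<close> and by the coordinates \<open>j\<close>; \<open>\<alpha>0 k\<close> stands for
  \<open>\<alpha>\<^sub>k\<^sub>0\<close>. Two conventions are built into the formula for \<open>f\<close>, which is only imposed on the disc: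
  \<^item> Both \<open>1 - cnj (\<alpha> k j) * z\<close> and \<open>1 - cnj (\<alpha>0 k) * z\<close> have positive real part on the disc, so
    their quotient avoids the nonpositive reals and the principal power is the holomorphic branch
    with value \<open>1\<close> at \<open>0\<close>.
  \<^item> If \<open>\<alpha> k j\<close> has modulus \<open>1\<close>, the Blaschke quotient equals \<open>- \<alpha> k j\<close> on the disc, so the
    boundary case needs no separate clause.
\<close>

definition star_form ::
  "nat \<Rightarrow> real ^ 'n \<Rightarrow> (complex \<Rightarrow> complex ^ 'n) \<Rightarrow> ('n \<Rightarrow> complex) \<Rightarrow>
   (nat \<Rightarrow> 'n \<Rightarrow> complex) \<Rightarrow> (nat \<Rightarrow> complex) \<Rightarrow> (nat \<Rightarrow> 'n \<Rightarrow> nat) \<Rightarrow> bool" where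
  "star_form m p f a \<alpha> \<alpha>0 r \<longleftrightarrow>
     f ` ball 0 1 \<subseteq> cellipsoid p \<and>
     (\<forall>j. a j \<noteq> 0) \<and>
     (\<forall>k\<in>{1..m-1}. \<forall>j. \<alpha> k j \<in> cball 0 1) \<and>
     (\<forall>k\<in>{1..m-1}. \<alpha>0 k \<in> ball 0 1) \<and>
     (\<forall>k\<in>{1..m-1}. \<forall>j. r k j \<in> {0, 1}) \<and>
     (\<forall>z\<in>ball 0 1. \<forall>j. f z $ j = a j *
        (\<Prod>k=1..m-1. ((z - \<alpha> k j) / (1 - cnj (\<alpha> k j) * z)) ^ r k j *
                     ((1 - cnj (\<alpha> k j) * z) / (1 - cnj (\<alpha>0 k) * z)) powr of_real (1 / p $ j))) \<and>
     (\<forall>z. (\<Sum>j\<in>UNIV. of_real (cmod (a j) powr (2 * p $ j)) *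
              (\<Prod>k=1..m-1. (z - \<alpha> k j) * (1 - cnj (\<alpha> k j) * z))) =
           (\<Prod>k=1..m-1. (z - \<alpha>0 k) * (1 - cnj (\<alpha>0 k) * z))) \<and>
     \<not> f constant_on ball 0 1"

end

theory Submission
  imports Defs
begin

text \<open>
  Every map of the form \<open>(\<ast>\<^sub>m)\<close> with all \<open>p\<^sub>j \<ge> 1/2\<close> is already an \<open>m\<close>-extremal, and an
  \<open>m\<close>-extremal is an \<open>l\<close>-extremal for all \<open>l \<ge> m\<close>. In the second claim \<open>p\<^sub>j \<ge> q\<^sub>j \<ge> 1/2\<close>.

  Suppose that \<open>h\<close> interpolates \<open>f\<close> at \<open>\<mu>\<^sub>1, \<dots>, \<mu>\<^sub>m\<close>. On the unit circle
  \<open>\<Sum>\<^sub>j |f\<^sub>j| powr (2 p\<^sub>j) = 1\<close>, so convexity of \<open>w \<mapsto> |w| powr (2 p\<^sub>j)\<close> bounds a weighted sum of the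
  \<open>Re (h\<^sub>j / f\<^sub>j - 1)\<close> above by a negative number. Up to a positive factor, this sum is the real part
  of \<open>F(z)\<close> divided by \<open>z\<close> to the power \<open>m - 1\<close>, where \<open>F\<close> is holomorphic in the disc and vanishes
  at all \<open>\<mu>\<^sub>i\<close>. Since \<open>(z - \<mu>)(1 - cnj \<mu> z) / z = |1 - cnj \<mu> z|\<^sup>2\<close> on the circle, dividing by
  these positive factors for \<open>i < m\<close> cancels the pole at \<open>0\<close>. The quotient is holomorphic, has
  negative real part on the circle and still vanishes at \<open>\<mu>\<^sub>m\<close>, against the maximum principle.
\<close>

section \<open>The disc algebra and division by zeros in the disc\<close>

text \<open>Holomorphy near the closed disc would be too strong: a power of
  \<open>1 - cnj \<alpha> * z\<close> with \<open>cmod \<alpha> = 1\<close> branches at the boundary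
  point \<open>\<alpha>\<close>, but may still be continuous there.\<close>

definition disc_algebra :: "(complex \<Rightarrow> complex) \<Rightarrow> bool" where
  "disc_algebra g \<longleftrightarrow> continuous_on (cball 0 1) g \<and> g holomorphic_on ball 0 1"

lemma disc_algebra_const: "disc_algebra (\<lambda>z. c)"
  by (simp add: disc_algebra_def)

lemma disc_algebra_id: "disc_algebra (\<lambda>z. z)"
  by (simp add: disc_algebra_def)

lemma disc_algebra_diff: "disc_algebra g \<Longrightarrow> disc_algebra h \<Longrightarrow> disc_algebra (\<lambda>z. g z - h z)"
  by (auto simp: disc_algebra_def intro!: continuous_intros holomorphic_intros)

lemma disc_algebra_mult: "disc_algebra g \<Longrightarrow> disc_algebra h \<Longrightarrow> disc_algebra (\<lambda>z. g z * h z)"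
  by (auto simp: disc_algebra_def intro!: continuous_intros holomorphic_intros)

lemma disc_algebra_divide:
  assumes "disc_algebra g" "disc_algebra h" "\<And>z. z \<in> cball 0 1 \<Longrightarrow> h z \<noteq> 0"
  shows "disc_algebra (\<lambda>z. g z / h z)"
  using assms by (auto simp: disc_algebra_def intro!: continuous_intros holomorphic_intros)

lemma disc_algebra_power: "disc_algebra g \<Longrightarrow> disc_algebra (\<lambda>z. g z ^ n)"
  by (auto simp: disc_algebra_def intro!: continuous_intros holomorphic_intros)

lemma disc_algebra_sum:
  "(\<And>i. i \<in> I \<Longrightarrow> disc_algebra (g i)) \<Longrightarrow> disc_algebra (\<lambda>z. \<Sum>i\<in>I. g i z)"
  by (auto simp: disc_algebra_def intro!: continuous_intros holomorphic_intros)

lemma disc_algebra_prod: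
  "(\<And>i. i \<in> I \<Longrightarrow> disc_algebra (g i)) \<Longrightarrow> disc_algebra (\<lambda>z. \<Prod>i\<in>I. g i z)"
  by (auto simp: disc_algebra_def intro!: continuous_intros holomorphic_intros)

lemmas disc_algebra_intros =
  disc_algebra_const disc_algebra_id disc_algebra_diff disc_algebra_mult
  disc_algebra_divide disc_algebra_power disc_algebra_sum disc_algebra_prod

text \<open>The difference quotient, completed by the derivative at \<open>\<mu>\<close>, is
  holomorphic by removal of the singularity. On the circle \<open>z\<close> stays away from
  \<open>\<mu>\<close>, so continuity is inherited from \<open>g\<close>.\<close>

lemma disc_algebra_factor:
  assumes g: "disc_algebra g" and \<mu>: "\<mu> \<in> ball 0 1" "g \<mu> = 0"
  obtains h where "disc_algebra h" "\<And>z. g z = (z - \<mu>) * h z"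
proof -
  define h where "h z = (if z = \<mu> then deriv g \<mu> else (g z - g \<mu>) / (z - \<mu>))" for z
  have hol: "h holomorphic_on ball 0 1"
    unfolding h_def using g pole_lemma_open[of g "ball 0 1" \<mu>] by (simp add: disc_algebra_def)
  have "continuous_on (ball 0 1) h"
    using hol holomorphic_on_imp_continuous_on by blast
  moreover have "continuous (at z within cball 0 1) h" if "z \<in> sphere 0 1" for z
  proof -
    have ne: "z \<noteq> \<mu>" using that \<mu> by auto
    have "continuous (at z within cball 0 1) (\<lambda>z. (g z - g \<mu>) / (z - \<mu>))"
      using g that ne
      by (auto intro!: continuous_intros simp: disc_algebra_def continuous_on_eq_continuous_within)
    moreover have "\<forall>\<^sub>F w in at z within cball 0 1. (g w - g \<mu>) / (w - \<mu>) = h w"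
      using eventually_neq_at_within[of \<mu> z "cball 0 1"] by eventually_elim (simp add: h_def)
    ultimately show ?thesis
      using ne by (auto simp: continuous_within h_def intro: Lim_transform_eventually)
  qed
  ultimately have "continuous_on (cball 0 1) h"
    by (simp add: continuous_on_eq_continuous_within)
      (metis at_within_interior continuous_on_eq_continuous_at interior_cball interior_ball
        open_ball centre_in_ball dist_norm mem_ball mem_sphere ball_subset_cball
        less_eq_real_def mem_ball_0 mem_cball_0 mem_sphere_0)
  with hol have "disc_algebra h" by (simp add: disc_algebra_def)
  moreover have "g z = (z - \<mu>) * h z" for z
    using \<mu> by (simp add: h_def)
  ultimately show ?thesis using that by blast
qed

text \<open>The nodes are distinct, so the factors already split off do not vanish at the next node,
  and the remaining quotient must.\<close>

lemma disc_algebra_factor_prod: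
  assumes "finite I" "inj_on \<mu> I" "\<mu> ` I \<subseteq> ball 0 1"
    and "disc_algebra g" "\<And>i. i \<in> I \<Longrightarrow> g (\<mu> i) = 0"
  shows "\<exists>h. disc_algebra h \<and> (\<forall>z. g z = (\<Prod>i\<in>I. z - \<mu> i) * h z)"
  using assms
proof (induction I rule: finite_induct)
  case empty
  then show ?case by auto
next
  case (insert i I)
  then obtain h where h: "disc_algebra h" "\<forall>z. g z = (\<Prod>i\<in>I. z - \<mu> i) * h z"
    by auto
  have "(\<Prod>l\<in>I. \<mu> i - \<mu> l) \<noteq> 0"
    using insert by (auto simp: prod_zero_iff)
  then have "h (\<mu> i) = 0"
    using h(2) insert.prems(4)[of i] by simp
  then obtain h' where "disc_algebra h'" "\<And>z. h z = (z - \<mu> i) * h' z"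
    using disc_algebra_factor[OF h(1)] insert.prems(2) by auto
  then show ?case
    using h(2) insert.hyps by (intro exI[of _ h']) (simp add: mult_ac)
qed

section \<open>Maximum principle for real parts; exceptional points on the circle\<close>

text \<open>\<open>exp (g z)\<close> has modulus \<open>exp (Re (g z))\<close>, hence at most 1 on
  the circle, and takes the value 1 at \<open>\<xi>\<close>. The maximum modulus principle makes it
  constant.\<close>

lemma Re_eq_zero_if_nonpos_on_sphere:
  assumes g: "disc_algebra g" and nonpos: "\<And>z. z \<in> sphere 0 1 \<Longrightarrow> Re (g z) \<le> 0"
    and \<xi>: "\<xi> \<in> ball 0 1" "g \<xi> = 0" and z: "z \<in> cball 0 1"
  shows "Re (g z) = 0"
proof -
  have cont: "continuous_on (cball 0 1) (\<lambda>z. exp (g z))"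
    and hol: "(\<lambda>z. exp (g z)) holomorphic_on ball 0 1"
    using g by (auto simp: disc_algebra_def intro!: continuous_intros holomorphic_intros)
  have le: "norm (exp (g w)) \<le> 1" if "w \<in> ball 0 1" for w
  proof (rule maximum_modulus_frontier[of "\<lambda>z. exp (g z)" "ball 0 1"])
    show "w \<in> ball 0 1" by fact
  qed (use cont hol nonpos in auto)
  have "(\<lambda>z. exp (g z)) constant_on ball 0 1"
    by (rule maximum_modulus_principle[OF hol, of "ball 0 1" \<xi>]) (use \<xi> le in auto)
  then have one: "exp (g w) = 1" if "w \<in> ball 0 1" for w
    using \<xi> that unfolding constant_on_def by (metis exp_zero)
  have "exp (g z) = 1"
    by (rule continuous_constant_on_closure[of "ball 0 1"]) (use one cont z in auto)
  then have "norm (exp (g z)) = 1" by simp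
  then show ?thesis by simp
qed

text \<open>A connected set with more than one point has no isolated points, and deleting finitely
  many points keeps every limit point.\<close>

lemma sphere_subset_closure_cofinite:
  assumes "finite E"
  shows "sphere (0::complex) 1 \<subseteq> closure (sphere 0 1 - E)"
proof
  fix z :: complex assume z: "z \<in> sphere 0 1"
  have "sphere 0 1 \<noteq> {w}" for w :: complex
    by (metis insert_iff mem_sphere_0 norm_one norm_minus_cancel one_neq_neg_one singletonD)
  then have "z islimpt sphere 0 1"
    using z by (intro connected_imp_perfect connected_sphere) auto
  then have "z islimpt (E \<union> (sphere 0 1 - E))"
    by (rule islimpt_subset) auto
  then have "z islimpt (sphere 0 1 - E)"
    using islimpt_Un_finite[OF assms] by blast
  then show "z \<in> closure (sphere 0 1 - E)"
    by (simp add: closure_def)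
qed

section \<open>Convexity of powers of the modulus\<close>

lemma powr_ge_tangent_at_one:
  fixes u s :: real
  assumes "u \<ge> 0" "s \<ge> 1"
  shows "1 + s * (u - 1) \<le> u powr s"
proof (cases "u = 0")
  case False
  with assms have u: "u > 0" by simp
  have "s * 1 powr (s - 1) * (u - 1) \<le> u powr s - 1 powr s"
    by (rule convex_on_imp_above_tangent[OF powr_convex[OF assms(2)]])
      (use u in \<open>auto intro!: derivative_eq_intros simp: interior_open\<close>)
  then show ?thesis by simp
qed (use assms in auto)

text \<open>The tangent inequality at 1, applied to \<open>cmod (w / v)\<close> and weakened by
  \<open>Re \<le> cmod\<close>. The bound is affine in \<open>Re (w / v)\<close>, which makes it
  accessible to holomorphic methods.\<close>

lemma norm_powr_ge_tangent:
  fixes v w :: complex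
  assumes "v \<noteq> 0" "s \<ge> 1"
  shows "cmod v powr s * (1 + s * (Re (w / v) - 1)) \<le> cmod w powr s"
proof -
  have "1 + s * (Re (w / v) - 1) \<le> 1 + s * (cmod (w / v) - 1)"
    using assms(2) complex_Re_le_cmod[of "w / v"] by auto
  also have "\<dots> \<le> cmod (w / v) powr s"
    by (rule powr_ge_tangent_at_one) (use assms in auto)
  finally have "cmod v powr s * (1 + s * (Re (w / v) - 1)) \<le> cmod v powr s * cmod (w / v) powr s"
    by (rule mult_left_mono) simp
  also have "\<dots> = cmod w powr s"
    using assms(1) by (simp add: norm_divide powr_mult[symmetric])
  finally show ?thesis .
qed

section \<open>Principal powers and Blaschke factors up to the circle\<close>

text \<open>Both arguments lie strictly between -pi/2 and pi/2, so their difference stays in the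
  principal range and the logarithms subtract without a correction.\<close>

lemma powr_divide_Re_pos:
  assumes "Re w > 0" "Re z > 0"
  shows "(w / z) powr c = w powr c * z powr (- c)"
proof -
  have nz: "w \<noteq> 0" "z \<noteq> 0" using assms by auto
  have "Ln (w * inverse z) = Ln w + Ln (inverse z)"
    using nz assms Re_Ln_pos_lt_imp[of w] Re_Ln_pos_lt_imp[of z]
    by (intro Ln_times_simple) (auto simp: Ln_inverse complex_nonpos_Reals_iff abs_if split: if_splits)
  then show ?thesis
    using nz assms
    by (simp add: powr_def divide_inverse exp_add[symmetric] Ln_inverse
        complex_nonpos_Reals_iff right_diff_distrib)
qed

lemma Re_one_minus_pos:
  assumes "cmod w \<le> 1" "w \<noteq> 1"
  shows "Re (1 - w) > 0"
proof (rule ccontr)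
  assume "\<not> ?thesis"
  then have "Re w = 1" using assms(1) complex_Re_le_cmod[of w] by simp
  then have "Im w = 0"
    using assms(1) cmod_power2[of w] power_le_one[of "cmod w" 2] by simp
  with \<open>Re w = 1\<close> have "w = 1" by (simp add: complex_eq_iff)
  then show False using assms(2) by simp
qed

text \<open>For \<open>cmod \<alpha> = 1\<close> the plain quotient would be
  \<open>0 / 0 = 0\<close> at \<open>z = \<alpha>\<close>; the separate case keeps the function
  continuous on the closed disc.\<close>

definition blaschke :: "complex \<Rightarrow> complex \<Rightarrow> complex" where
  "blaschke \<alpha> z = (if cmod \<alpha> = 1 then - \<alpha> else (z - \<alpha>) / (1 - cnj \<alpha> * z))"

lemma cnj_mult_in_cball: "\<alpha> \<in> cball 0 1 \<Longrightarrow> z \<in> cball 0 1 \<Longrightarrow> cmod (cnj \<alpha> * z) \<le> 1"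
  by (simp add: norm_mult mult_le_one)

lemma cnj_mult_in_ball:
  assumes "\<alpha> \<in> cball 0 1" "z \<in> cball 0 1" "\<alpha> \<in> ball 0 1 \<or> z \<in> ball 0 1"
  shows "cmod (cnj \<alpha> * z) < 1"
proof -
  have "cmod \<alpha> * cmod z < 1"
    using assms mult_left_le_one_le[of "cmod z" "cmod \<alpha>"] mult_left_le_one_le[of "cmod \<alpha>" "cmod z"]
    by (auto simp: mult.commute)
  then show ?thesis by (simp add: norm_mult)
qed

lemma one_minus_cnj_mult_nz:
  assumes "\<alpha> \<in> cball 0 1" "z \<in> cball 0 1" "\<alpha> \<in> ball 0 1 \<or> z \<in> ball 0 1"
  shows "1 - cnj \<alpha> * z \<noteq> 0" "Re (1 - cnj \<alpha> * z) > 0"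
proof -
  show "1 - cnj \<alpha> * z \<noteq> 0"
    using cnj_mult_in_ball[OF assms] by auto
  then show "Re (1 - cnj \<alpha> * z) > 0"
    using Re_one_minus_pos[OF cnj_mult_in_cball[OF assms(1,2)]] by fastforce
qed

lemma blaschke_mult:
  assumes "\<alpha> \<in> cball 0 1" "z \<in> cball 0 1"
  shows "blaschke \<alpha> z * (1 - cnj \<alpha> * z) = z - \<alpha>"
proof (cases "cmod \<alpha> = 1")
  case True
  then have "\<alpha> * cnj \<alpha> = 1" by (simp add: complex_norm_square[symmetric])
  then show ?thesis using True
    by (simp add: blaschke_def right_diff_distrib mult.assoc[symmetric])
next
  case False
  then show ?thesis
    using one_minus_cnj_mult_nz(1)[of \<alpha> z] assms by (simp add: blaschke_def)
qed

lemma disc_algebra_blaschke: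
  assumes "\<alpha> \<in> cball 0 1"
  shows "disc_algebra (blaschke \<alpha>)"
proof (cases "cmod \<alpha> = 1")
  case False
  then have "1 - cnj \<alpha> * z \<noteq> 0" if "z \<in> cball 0 1" for z
    using one_minus_cnj_mult_nz(1)[of \<alpha> z] assms that by simp
  with False show ?thesis
    unfolding blaschke_def by (simp, intro disc_algebra_intros) auto
next
  case True
  then have "blaschke \<alpha> = (\<lambda>z. - \<alpha>)" by (auto simp: blaschke_def)
  then show ?thesis by (simp add: disc_algebra_const)
qed

lemma mult_one_minus_cnj_on_sphere:
  assumes "z \<in> sphere 0 1"
  shows "(z - \<alpha>) * (1 - cnj \<alpha> * z) = z * of_real ((cmod (1 - cnj \<alpha> * z))\<^sup>2)"
proof -
  have "z * cnj z = 1" using assms by (simp add: complex_norm_square[symmetric])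
  then have "z - \<alpha> = z * cnj (1 - cnj \<alpha> * z)"
    by (simp add: algebra_simps)
  then show ?thesis
    by (simp only: complex_norm_square mult_ac)
qed

lemma cmod_blaschke_on_sphere:
  assumes "\<alpha> \<in> cball 0 1" "z \<in> sphere 0 1"
  shows "cmod (blaschke \<alpha> z) = 1"
proof (cases "cmod \<alpha> = 1")
  case False
  then have nz: "1 - cnj \<alpha> * z \<noteq> 0"
    using one_minus_cnj_mult_nz(1)[of \<alpha> z] assms by simp
  have "z * cnj z = 1" using assms by (simp add: complex_norm_square[symmetric])
  then have "z - \<alpha> = z * cnj (1 - cnj \<alpha> * z)"
    by (simp add: algebra_simps)
  then have "cmod (z - \<alpha>) = cmod (1 - cnj \<alpha> * z)"
    using assms by (metis complex_mod_cnj mem_sphere_0 mult_1 norm_mult)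
  with False nz show ?thesis by (simp add: blaschke_def norm_divide)
qed (simp add: blaschke_def)

text \<open>
  Isabelle has \<open>0 powr 0 = 0\<close>; the value \<open>1\<close> is needed for continuity of
  \<open>(1 - cnj \<alpha> * z) powr (2 - 1 / p\<^sub>j)\<close> at \<open>z = \<alpha>\<close> when \<open>|\<alpha>| = 1\<close> and \<open>p\<^sub>j = 1/2\<close>.
\<close>

definition powr1 :: "complex \<Rightarrow> real \<Rightarrow> complex" where
  "powr1 w t = (if t = 0 then 1 else w powr of_real t)"

lemma powr1_eq: "w \<noteq> 0 \<Longrightarrow> powr1 w t = w powr of_real t"
  by (simp add: powr1_def)

text \<open>A positive power is continuous on the closed right half-plane, including 0. For
  \<open>\<alpha>\<close> in the open disc the base never reaches 0, so negative exponents are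
  allowed too.\<close>

lemma disc_algebra_powr1:
  assumes "\<alpha> \<in> cball 0 1" "t \<ge> 0 \<or> \<alpha> \<in> ball 0 1"
  shows "disc_algebra (\<lambda>z. powr1 (1 - cnj \<alpha> * z) t)"
proof (cases "t = 0")
  case False
  have "Re (1 - cnj \<alpha> * z) \<ge> 0" if "z \<in> cball 0 1" for z
    using complex_Re_le_cmod[of "cnj \<alpha> * z"] cnj_mult_in_cball[OF assms(1) that]
    by (simp only: minus_complex.sel one_complex.sel)
  moreover have "t > 0" if "z \<in> cball 0 1" "1 - cnj \<alpha> * z = 0" for z
    using assms False one_minus_cnj_mult_nz(1)[of \<alpha> z] that by auto
  ultimately have "continuous_on (cball 0 1) (\<lambda>z. (1 - cnj \<alpha> * z) powr of_real t)"
    by (intro continuous_intros) auto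
  moreover have "(\<lambda>z. (1 - cnj \<alpha> * z) powr of_real t) holomorphic_on ball 0 1"
    using one_minus_cnj_mult_nz(2)[of \<alpha>] assms(1)
    by (intro holomorphic_intros)
      (metis ball_subset_cball complex_nonpos_Reals_iff not_le subsetD)
  ultimately show ?thesis using False by (simp add: disc_algebra_def powr1_def)
qed (simp add: powr1_def disc_algebra_const)

section \<open>Factors of the components and their cofactors\<close>

text \<open>With \<open>t = 1 / p $ j\<close> this is one factor of \<open>f z $ j\<close>.
  Splitting the power of the quotient gives an expression that extends to the closed disc.\<close>

definition star_factor :: "complex \<Rightarrow> complex \<Rightarrow> nat \<Rightarrow> real \<Rightarrow> complex \<Rightarrow> complex" where
  "star_factor \<alpha> \<beta> r t z =
     blaschke \<alpha> z ^ r * powr1 (1 - cnj \<alpha> * z) t * powr1 (1 - cnj \<beta> * z) (- t)"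

text \<open>
  The cofactor that turns a factor of \<open>f\<^sub>j\<close> (with \<open>t = 1 / p\<^sub>j\<close>) into \<open>(z - \<alpha>) (1 - cnj \<alpha> z)\<close>. It has
  no singularity at boundary points \<open>\<alpha>\<close> precisely when \<open>p\<^sub>j \<ge> 1/2\<close>.
\<close>

definition dual_factor :: "complex \<Rightarrow> complex \<Rightarrow> nat \<Rightarrow> real \<Rightarrow> complex \<Rightarrow> complex" where
  "dual_factor \<alpha> \<beta> r t z =
     blaschke \<alpha> z ^ (1 - r) * powr1 (1 - cnj \<alpha> * z) (2 - t) * powr1 (1 - cnj \<beta> * z) t"

lemma disc_algebra_star_factor:
  assumes "\<alpha> \<in> cball 0 1" "\<beta> \<in> ball 0 1" "t > 0"
  shows "disc_algebra (star_factor \<alpha> \<beta> r t)"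
  unfolding star_factor_def using assms
  by (intro disc_algebra_intros disc_algebra_blaschke disc_algebra_powr1) auto

lemma disc_algebra_dual_factor:
  assumes "\<alpha> \<in> cball 0 1" "\<beta> \<in> ball 0 1" "t \<le> 2"
  shows "disc_algebra (dual_factor \<alpha> \<beta> r t)"
  unfolding dual_factor_def using assms
  by (intro disc_algebra_intros disc_algebra_blaschke disc_algebra_powr1) auto

lemma star_factor_eq:
  assumes "\<alpha> \<in> cball 0 1" "\<beta> \<in> ball 0 1" "z \<in> ball 0 1"
  shows "((z - \<alpha>) / (1 - cnj \<alpha> * z)) ^ r *
           ((1 - cnj \<alpha> * z) / (1 - cnj \<beta> * z)) powr of_real t = star_factor \<alpha> \<beta> r t z"
proof -
  have z: "z \<in> cball 0 1" and \<beta>: "\<beta> \<in> cball 0 1"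
    using assms by auto
  have nz: "1 - cnj \<alpha> * z \<noteq> 0" "1 - cnj \<beta> * z \<noteq> 0"
    and pos: "Re (1 - cnj \<alpha> * z) > 0" "Re (1 - cnj \<beta> * z) > 0"
    using one_minus_cnj_mult_nz[OF assms(1) z] one_minus_cnj_mult_nz[OF \<beta> z] assms by auto
  have "(z - \<alpha>) / (1 - cnj \<alpha> * z) = blaschke \<alpha> z"
    using blaschke_mult[OF assms(1) z] nz by (simp add: divide_eq_eq)
  then show ?thesis
    using powr_divide_Re_pos[OF pos, of "of_real t"] nz
    by (simp add: star_factor_def powr1_eq mult.assoc)
qed

text \<open>The exponents pair up: \<open>r\<close> and \<open>1 - r\<close> give one Blaschke
  factor, \<open>t\<close> and \<open>2 - t\<close> a square, and \<open>- t\<close> and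
  \<open>t\<close> cancel.\<close>

lemma star_factor_mult_dual_factor:
  assumes "\<alpha> \<in> cball 0 1" "\<beta> \<in> ball 0 1" "z \<in> cball 0 1" "1 - cnj \<alpha> * z \<noteq> 0" "r \<in> {0, 1}"
  shows "star_factor \<alpha> \<beta> r t z * dual_factor \<alpha> \<beta> r t z = (z - \<alpha>) * (1 - cnj \<alpha> * z)"
proof -
  let ?b = "1 - cnj \<alpha> * z" and ?c = "1 - cnj \<beta> * z"
  have c: "?c \<noteq> 0"
    using one_minus_cnj_mult_nz(1)[of \<beta> z] assms by auto
  have "?b powr of_real t * ?b powr of_real (2 - t) = ?b\<^sup>2"
    using assms(4) by (simp flip: powr_add of_real_add)
  moreover have "?c powr of_real (- t) * ?c powr of_real t = 1"
    using c by (simp flip: powr_add of_real_add)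
  moreover have "blaschke \<alpha> z ^ r * blaschke \<alpha> z ^ (1 - r) = blaschke \<alpha> z"
    using assms(5) by auto
  moreover have "star_factor \<alpha> \<beta> r t z * dual_factor \<alpha> \<beta> r t z =
      (blaschke \<alpha> z ^ r * blaschke \<alpha> z ^ (1 - r)) * (?b powr of_real t * ?b powr of_real (2 - t)) *
      (?c powr of_real (- t) * ?c powr of_real t)"
    unfolding star_factor_def dual_factor_def powr1_eq[OF assms(4)] powr1_eq[OF c]
    by (simp only: mult_ac)
  ultimately have "star_factor \<alpha> \<beta> r t z * dual_factor \<alpha> \<beta> r t z = blaschke \<alpha> z * ?b * ?b"
    by (simp only: power2_eq_square mult_1_right mult.assoc)
  then show ?thesis
    using blaschke_mult[OF assms(1,3)] by simp
qed

text \<open>The Blaschke factor is unimodular on the circle, and the exponent \<open>2 / t\<close>,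
  which is \<open>2 * p $ j\<close> for \<open>t = 1 / p $ j\<close>, turns the powers into
  squares.\<close>

lemma cmod_star_factor_on_sphere:
  assumes "\<alpha> \<in> cball 0 1" "\<beta> \<in> ball 0 1" "z \<in> sphere 0 1" "1 - cnj \<alpha> * z \<noteq> 0" "t > 0"
  shows "cmod (star_factor \<alpha> \<beta> r t z) powr (2 / t) =
           (cmod (1 - cnj \<alpha> * z))\<^sup>2 / (cmod (1 - cnj \<beta> * z))\<^sup>2"
proof -
  let ?b = "1 - cnj \<alpha> * z" and ?c = "1 - cnj \<beta> * z"
  have c: "?c \<noteq> 0"
    using one_minus_cnj_mult_nz(1)[of \<beta> z] assms by auto
  have "cmod (star_factor \<alpha> \<beta> r t z) = cmod ?b powr t * cmod ?c powr (- t)"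
    using assms c cmod_blaschke_on_sphere[of \<alpha> z]
    by (simp add: star_factor_def powr1_eq norm_mult norm_power norm_powr_real_powr'
        flip: of_real_minus)
  also have "\<dots> powr (2 / t) = cmod ?b powr 2 * cmod ?c powr (- 2)"
    using assms(5) by (simp add: powr_mult powr_powr)
  also have "\<dots> = (cmod ?b)\<^sup>2 / (cmod ?c)\<^sup>2"
    using assms(4) c by (simp add: powr_minus divide_inverse)
  finally show ?thesis .
qed

lemma prod_mult_one_minus_cnj_on_sphere:
  assumes "z \<in> sphere 0 1"
  shows "(\<Prod>k\<in>K. (z - \<alpha> k) * (1 - cnj (\<alpha> k) * z)) =
           z ^ card K * of_real (\<Prod>k\<in>K. (cmod (1 - cnj (\<alpha> k) * z))\<^sup>2)"
  by (simp add: mult_one_minus_cnj_on_sphere[OF assms] prod.distrib)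

lemma star_form_eq:
  fixes p :: "real ^ 'n"
  assumes star: "star_form m p f a \<alpha> \<alpha>0 r" and z: "z \<in> ball 0 1"
  shows "f z $ j = a j * (\<Prod>k=1..m-1. star_factor (\<alpha> k j) (\<alpha>0 k) (r k j) (1 / p $ j) z)"
proof -
  have "star_factor (\<alpha> k j) (\<alpha>0 k) (r k j) (1 / p $ j) z =
      ((z - \<alpha> k j) / (1 - cnj (\<alpha> k j) * z)) ^ r k j *
        ((1 - cnj (\<alpha> k j) * z) / (1 - cnj (\<alpha>0 k) * z)) powr of_real (1 / p $ j)"
    if "k \<in> {1..m-1}" for k
    using star that by (intro star_factor_eq[symmetric] z) (simp_all add: star_form_def)
  moreover have "f z $ j = a j *
      (\<Prod>k=1..m-1. ((z - \<alpha> k j) / (1 - cnj (\<alpha> k j) * z)) ^ r k j *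
        ((1 - cnj (\<alpha> k j) * z) / (1 - cnj (\<alpha>0 k) * z)) powr of_real (1 / p $ j))"
    using star z by (simp add: star_form_def)
  ultimately show ?thesis by simp
qed

section \<open>Impossibility of interpolation at \<open>m\<close> nodes\<close>

lemma star_form_no_interpolant:
  fixes p :: "real ^ 'n"
  assumes m: "m \<ge> 2" and p: "\<And>j. p $ j \<ge> 1/2" and star: "star_form m p f a \<alpha> \<alpha>0 r"
    and \<mu>: "\<mu> ` {1..m} \<subseteq> ball 0 1" "inj_on \<mu> {1..m}"
    and U: "cball 0 1 \<subseteq> U" "holomorphic_map_on h U" "h ` U \<subseteq> cellipsoid p"
    and eq: "\<And>i. i \<in> {1..m} \<Longrightarrow> h (\<mu> i) = f (\<mu> i)"
  shows False
proof -
  define K where "K = {1..m-1}"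
  have \<alpha>: "\<And>k j. k \<in> K \<Longrightarrow> \<alpha> k j \<in> cball 0 1" and \<alpha>0: "\<And>k. k \<in> K \<Longrightarrow> \<alpha>0 k \<in> ball 0 1"
    and r: "\<And>k j. k \<in> K \<Longrightarrow> r k j \<in> {0, 1}" and a: "\<And>j. a j \<noteq> 0"
    using star by (simp_all add: star_form_def K_def)
  have ident: "(\<Sum>j\<in>UNIV. of_real (cmod (a j) powr (2 * p $ j)) *
              (\<Prod>k\<in>K. (z - \<alpha> k j) * (1 - cnj (\<alpha> k j) * z))) =
           (\<Prod>k\<in>K. (z - \<alpha>0 k) * (1 - cnj (\<alpha>0 k) * z))" for z
    using star by (simp add: star_form_def K_def)
  have p_pos: "p $ j > 0" for j
    using p[of j] by linarith
  \<comment> \<open>\<open>e j\<close> extends the \<open>j\<close>-th component of \<open>f\<close>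
    continuously to the circle; \<open>f\<close> is only prescribed on the open disc.\<close>
  define e where "e j z = a j * (\<Prod>k\<in>K. star_factor (\<alpha> k j) (\<alpha>0 k) (r k j) (1 / p $ j) z)" for j z
  define G where "G j z = (\<Prod>k\<in>K. dual_factor (\<alpha> k j) (\<alpha>0 k) (r k j) (1 / p $ j) z)" for j z
  define A where "A j = cmod (a j) powr (2 * p $ j)" for j
  define V where "V j z = (\<Prod>k\<in>K. (cmod (1 - cnj (\<alpha> k j) * z))\<^sup>2)" for j z
  define V0 where "V0 z = (\<Prod>k\<in>K. (cmod (1 - cnj (\<alpha>0 k) * z))\<^sup>2)" for z
  \<comment> \<open>On the circle \<open>e j z * G j z = a j * z ^ (m - 1) * V j z\<close>. Dividing
    by \<open>a j\<close> therefore leaves \<open>z ^ (m - 1)\<close> times a real weight times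
    \<open>h z $ j / e j z - 1\<close>.\<close>
  define F where
    "F z = (\<Sum>j\<in>UNIV. of_real (p $ j * A j) / a j * G j z * (h z $ j - e j z))" for z
  \<comment> \<open>The estimate on the circle divides by \<open>e j z\<close>, which vanishes where \<open>z = \<alpha> k j\<close>; these
    finitely many points are recovered by continuity.\<close>
  define E where "E = (\<lambda>(k, j). \<alpha> k j) ` (K \<times> UNIV)"
  have fin_E: "finite E" by (simp add: E_def K_def)
  have e_f: "e j z = f z $ j" if "z \<in> ball 0 1" for j z
    using star_form_eq[OF star that] by (simp add: e_def K_def)
  have "disc_algebra (e j)" for j
    unfolding e_def using \<alpha> \<alpha>0 p_pos[of j]
    by (intro disc_algebra_intros disc_algebra_star_factor) auto
  moreover have "disc_algebra (G j)" for j
    unfolding G_def using \<alpha> \<alpha>0 p[of j]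
    by (intro disc_algebra_intros disc_algebra_dual_factor) (auto simp: field_simps)
  moreover have "disc_algebra (\<lambda>z. h z $ j)" for j
  proof -
    have "(\<lambda>z. h z $ j) holomorphic_on cball 0 1"
      using U(1,2) unfolding holomorphic_map_on_def by (blast intro: holomorphic_on_subset)
    then show ?thesis
      using holomorphic_on_imp_continuous_on holomorphic_on_subset ball_subset_cball
      unfolding disc_algebra_def by blast
  qed
  ultimately have disc_F: "disc_algebra F"
    unfolding F_def by (intro disc_algebra_intros) (use a in auto)
  have "F (\<mu> i) = 0" if "i \<in> {1..m}" for i
  proof -
    have "\<mu> i \<in> ball 0 1" using \<mu>(1) that by blast
    then show ?thesis by (simp add: F_def e_f eq[OF that])
  qed
  then obtain H where disc_H: "disc_algebra H" and F_H: "\<And>z. F z = (\<Prod>i=1..m. z - \<mu> i) * H z"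
    using disc_algebra_factor_prod[OF _ \<mu>(2,1) disc_F] by auto
  \<comment> \<open>\<open>K\<close> indexes both the parameters and all nodes but the last, so the
    products over these nodes carry exactly the power \<open>z ^ (m - 1)\<close>.\<close>
  have m_split: "{1..m} = insert m K" "m \<notin> K" "finite K" "card K = m - 1"
    using m by (auto simp: K_def)
  have \<mu>_ball: "\<mu> i \<in> ball 0 1" if "i \<in> K" for i
    using that \<mu>(1) m_split(1) by auto
  define W where "W z = (\<Prod>i\<in>K. (cmod (1 - cnj (\<mu> i) * z))\<^sup>2)" for z
  \<comment> \<open>Only the nodes in \<open>K\<close> are divided out, each as
    \<open>(z - \<mu> i) * (1 - cnj (\<mu> i) * z)\<close>; the factor \<open>z - \<mu> m\<close> is
    kept as the zero for the maximum principle.\<close>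
  define L where "L z = H z * (z - \<mu> m) / (\<Prod>i\<in>K. 1 - cnj (\<mu> i) * z)" for z
  have L_nz: "(\<Prod>i\<in>K. 1 - cnj (\<mu> i) * z) \<noteq> 0" if "z \<in> cball 0 1" for z
  proof -
    have "1 - cnj (\<mu> i) * z \<noteq> 0" if "i \<in> K" for i
      using \<mu>_ball[OF that] \<open>z \<in> cball 0 1\<close> by (intro one_minus_cnj_mult_nz(1)) auto
    then show ?thesis using m_split(3) by simp
  qed
  have disc_L: "disc_algebra L"
    unfolding L_def using L_nz disc_H by (intro disc_algebra_intros) auto
  have F_L: "F z = z ^ (m - 1) * of_real (W z) * L z" if z: "z \<in> sphere 0 1" for z
  proof -
    have "F z = (\<Prod>i\<in>K. (z - \<mu> i) * (1 - cnj (\<mu> i) * z)) * L z"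
      unfolding F_H m_split(1) L_def prod.distrib
      using L_nz[of z] z m_split(2,3) by (simp del: prod_zero_iff)
    then show ?thesis
      using prod_mult_one_minus_cnj_on_sphere[OF z, of \<mu> K] by (simp add: W_def m_split(4))
  qed
  have L_neg: "Re (L z) < 0" if "z \<in> sphere 0 1 - E" for z
  proof -
    have z: "z \<in> sphere 0 1" "z \<in> cball 0 1" "z \<noteq> 0" using that by auto
    have nz: "1 - cnj (\<alpha> k j) * z \<noteq> 0" if "k \<in> K" for k j
    proof
      assume "1 - cnj (\<alpha> k j) * z = 0"
      then have "(z - \<alpha> k j) * z = 0"
        using blaschke_mult[OF \<alpha>[OF that] z(2), of j] by simp
      then have "z \<in> E" using z(3) that by (force simp: E_def)
      then show False using \<open>z \<in> sphere 0 1 - E\<close> by simp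
    qed
    have V0_pos: "V0 z > 0" and W_pos: "W z > 0"
    proof -
      have "1 - cnj \<beta> * z \<noteq> 0" if "\<beta> \<in> ball 0 1" for \<beta>
        using that z(2) by (intro one_minus_cnj_mult_nz(1)) auto
      then show "V0 z > 0" "W z > 0"
        unfolding V0_def W_def using \<alpha>0 \<mu>_ball by (simp_all add: prod_pos)
    qed
    have cmod_e: "cmod (e j z) powr (2 * p $ j) = A j * V j z / V0 z" for j
    proof -
      have "cmod (star_factor (\<alpha> k j) (\<alpha>0 k) (r k j) (1 / p $ j) z) powr (2 * p $ j) =
          (cmod (1 - cnj (\<alpha> k j) * z))\<^sup>2 / (cmod (1 - cnj (\<alpha>0 k) * z))\<^sup>2" if "k \<in> K" for k
        using cmod_star_factor_on_sphere[OF \<alpha> \<alpha>0 z(1) nz, OF that that that, where t = "1 / p $ j"]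
          p_pos[of j] by simp
      moreover have "cmod (e j z) powr (2 * p $ j) = A j *
          (\<Prod>k\<in>K. cmod (star_factor (\<alpha> k j) (\<alpha>0 k) (r k j) (1 / p $ j) z) powr (2 * p $ j))"
        by (simp add: e_def A_def norm_mult powr_mult prod_norm[symmetric] prod_powr_distrib)
      ultimately show ?thesis by (simp add: V_def V0_def prod_dividef)
    qed
    have e_nz: "e j z \<noteq> 0" for j
      using cmod_e[of j] a V0_pos nz m_split(3) by (auto simp: A_def V_def)
    have e_G: "e j z * G j z = a j * (z ^ (m - 1) * of_real (V j z))" for j
    proof -
      have "(\<Prod>k\<in>K. star_factor (\<alpha> k j) (\<alpha>0 k) (r k j) (1 / p $ j) z *
              dual_factor (\<alpha> k j) (\<alpha>0 k) (r k j) (1 / p $ j) z) =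
            (\<Prod>k\<in>K. (z - \<alpha> k j) * (1 - cnj (\<alpha> k j) * z))"
        using star_factor_mult_dual_factor[OF \<alpha> \<alpha>0 z(2) nz r] by (intro prod.cong) auto
      also have "\<dots> = z ^ (m - 1) * of_real (V j z)"
        using prod_mult_one_minus_cnj_on_sphere[OF z(1), of "\<lambda>k. \<alpha> k j" K]
        by (simp add: V_def m_split(4))
      finally show ?thesis by (simp add: e_def G_def prod.distrib)
    qed
    \<comment> \<open>\<open>D\<close> is the real part of \<open>F z / z ^ (m - 1)\<close>, hence a
      positive multiple of \<open>Re (L z)\<close>.\<close>
    define D where "D = (\<Sum>j\<in>UNIV. p $ j * (A j * V j z) * (Re (h z $ j / e j z) - 1))"
    have "F z = z ^ (m - 1) *
        (\<Sum>j\<in>UNIV. of_real (p $ j * (A j * V j z)) * (h z $ j / e j z - 1))"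
      unfolding F_def sum_distrib_left
    proof (intro sum.cong refl)
      fix j
      have G_eq: "G j z = a j * (z ^ (m - 1) * of_real (V j z)) / e j z"
        using e_G[of j] e_nz[of j] by (simp add: field_simps)
      show "of_real (p $ j * A j) / a j * G j z * (h z $ j - e j z) =
          z ^ (m - 1) * (of_real (p $ j * (A j * V j z)) * (h z $ j / e j z - 1))"
        unfolding G_eq using a[of j] e_nz[of j] by (simp add: field_simps)
    qed
    then have "of_real (W z) * L z =
        (\<Sum>j\<in>UNIV. of_real (p $ j * (A j * V j z)) * (h z $ j / e j z - 1))"
      using F_L[OF z(1)] z(3) by (simp add: mult.assoc)
    then have "Re (of_real (W z) * L z) = D"
      by (simp only: Re_sum D_def Re_complex_of_real times_complex.sel Im_complex_of_real
          minus_complex.sel one_complex.sel mult_zero_left diff_zero)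
    then have WL: "W z * Re (L z) = D" by simp
    \<comment> \<open>The polynomial identity of \<open>star_form\<close>, divided by
      \<open>z ^ (m - 1)\<close>. Together with \<open>cmod_e\<close> it says that \<open>e\<close>
      maps such \<open>z\<close> into the boundary of the ellipsoid.\<close>
    have V0_eq: "V0 z = (\<Sum>j\<in>UNIV. A j * V j z)"
    proof -
      have "z ^ (m - 1) * of_real (\<Sum>j\<in>UNIV. A j * V j z) = z ^ (m - 1) * (of_real (V0 z) :: complex)"
        using ident[of z] unfolding prod_mult_one_minus_cnj_on_sphere[OF z(1)]
        by (simp add: A_def V_def V0_def m_split(4) sum_distrib_left mult_ac)
      then show ?thesis using z(3) by (simp only: mult_cancel_left of_real_eq_iff) simp
    qed
    \<comment> \<open>The tangent inequality at \<open>e j z\<close>, with exponent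
      \<open>2 * p $ j \<ge> 1\<close>, multiplied by \<open>V0 z\<close> so that the constant terms
      sum to \<open>V0 z\<close>.\<close>
    have "A j * V j z + 2 * (p $ j * (A j * V j z) * (Re (h z $ j / e j z) - 1)) \<le>
        V0 z * cmod (h z $ j) powr (2 * p $ j)" for j
    proof -
      have "A j * V j z / V0 z * (1 + 2 * p $ j * (Re (h z $ j / e j z) - 1)) \<le>
          cmod (h z $ j) powr (2 * p $ j)"
        using norm_powr_ge_tangent[OF e_nz[of j], of "2 * p $ j" "h z $ j"] p[of j]
        by (simp add: cmod_e)
      then have "V0 z * (A j * V j z / V0 z * (1 + 2 * p $ j * (Re (h z $ j / e j z) - 1))) \<le>
          V0 z * cmod (h z $ j) powr (2 * p $ j)"
        using V0_pos by (intro mult_left_mono) auto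
      then show ?thesis using V0_pos by (simp add: algebra_simps)
    qed
    then have "(\<Sum>j\<in>UNIV. A j * V j z + 2 * (p $ j * (A j * V j z) * (Re (h z $ j / e j z) - 1))) \<le>
        (\<Sum>j\<in>UNIV. V0 z * cmod (h z $ j) powr (2 * p $ j))"
      by (rule sum_mono)
    then have "V0 z + 2 * D \<le> V0 z * (\<Sum>j\<in>UNIV. cmod (h z $ j) powr (2 * p $ j))"
      unfolding sum.distrib sum_distrib_left[symmetric] V0_eq[symmetric] D_def .
    \<comment> \<open>Strictness comes from \<open>h\<close> mapping the closed disc, circle
      included, into the open ellipsoid.\<close>
    also have "\<dots> < V0 z * 1"
    proof -
      have "h z \<in> cellipsoid p" using U(1,3) z(2) by blast
      then show ?thesis using V0_pos by (intro mult_strict_left_mono) (auto simp: cellipsoid_def)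
    qed
    finally have "D < 0" by simp
    then show ?thesis using WL W_pos by (metis mult_less_0_iff not_less_iff_gr_or_eq)
  qed
  have nonpos: "Re (L z) \<le> 0" if "z \<in> sphere 0 1" for z
  proof (rule continuous_le_on_closure[of "sphere 0 1 - E" "\<lambda>z. Re (L z)"])
    have "closure (sphere 0 1 - E) \<subseteq> cball 0 1"
      by (rule closure_minimal) auto
    moreover have "continuous_on (cball 0 1) (\<lambda>z. Re (L z))"
      using disc_L by (auto simp: disc_algebra_def intro!: continuous_intros)
    ultimately show "continuous_on (closure (sphere 0 1 - E)) (\<lambda>z. Re (L z))"
      by (rule continuous_on_subset[rotated])
    show "z \<in> closure (sphere 0 1 - E)"
      using sphere_subset_closure_cofinite[OF fin_E] that by blast
  qed (use L_neg in force)
  \<comment> \<open>The maximum principle will give \<open>Re (L z) = 0\<close> on the whole closed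
    disc; one circle point off \<open>E\<close>, where the inequality is strict, contradicts
    this.\<close>
  have "sphere 0 1 - E \<noteq> {}"
    using sphere_subset_closure_cofinite[OF fin_E] by (metis closure_empty mem_sphere_0 norm_one empty_iff subsetD)
  then obtain z where z: "z \<in> sphere 0 1 - E" by blast
  have "\<mu> m \<in> ball 0 1" using \<mu>(1) m_split(1) by blast
  then have "Re (L z) = 0"
    using z by (intro Re_eq_zero_if_nonpos_on_sphere[OF disc_L nonpos, of "\<mu> m"]) (auto simp: L_def)
  with L_neg[OF z] show False by simp
qed

section \<open>Extremality for every number of nodes from \<open>m\<close> on\<close>

lemma star_form_holomorphic_map_on:
  fixes p :: "real ^ 'n"
  assumes p: "\<And>j. p $ j > 0" and star: "star_form m p f a \<alpha> \<alpha>0 r"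
  shows "holomorphic_map_on f (ball 0 1)"
  unfolding holomorphic_map_on_def
proof
  fix j
  let ?e = "\<lambda>z. a j * (\<Prod>k=1..m-1. star_factor (\<alpha> k j) (\<alpha>0 k) (r k j) (1 / p $ j) z)"
  have \<alpha>: "\<And>k. k \<in> {1..m-1} \<Longrightarrow> \<alpha> k j \<in> cball 0 1"
    and \<alpha>0: "\<And>k. k \<in> {1..m-1} \<Longrightarrow> \<alpha>0 k \<in> ball 0 1"
    using star by (simp_all add: star_form_def)
  have "disc_algebra ?e"
    using \<alpha> \<alpha>0 p[of j] by (intro disc_algebra_intros disc_algebra_star_factor) auto
  then have "?e holomorphic_on ball 0 1" by (simp add: disc_algebra_def)
  moreover have "?e z = f z $ j" if "z \<in> ball 0 1" for z
    using star_form_eq[OF star that] by simp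
  ultimately show "(\<lambda>z. f z $ j) holomorphic_on ball 0 1"
    by (rule holomorphic_transform)
qed

lemma star_form_l_extremal:
  fixes p :: "real ^ 'n"
  assumes m: "m \<ge> 2" "m \<le> l" and p: "\<And>j. p $ j \<ge> 1/2" and star: "star_form m p f a \<alpha> \<alpha>0 r"
  shows "l_extremal (cellipsoid p) l f"
  unfolding l_extremal_def
proof (intro conjI allI impI notI)
  have "p $ j > 0" for j using p[of j] by linarith
  then show "holomorphic_map_on f (ball 0 1)"
    using star by (rule star_form_holomorphic_map_on)
  show "f ` ball 0 1 \<subseteq> cellipsoid p" using star by (simp add: star_form_def)
next
  fix \<mu> :: "nat \<Rightarrow> complex"
  assume \<mu>: "\<mu> ` {1..l} \<subseteq> ball 0 1 \<and> inj_on \<mu> {1..l}"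
    and "\<exists>h U. open U \<and> cball 0 1 \<subseteq> U \<and> holomorphic_map_on h U \<and> h ` U \<subseteq> cellipsoid p \<and>
               (\<forall>j\<in>{1..l}. h (\<mu> j) = f (\<mu> j))"
  then obtain h U where h: "cball 0 1 \<subseteq> U" "holomorphic_map_on h U" "h ` U \<subseteq> cellipsoid p"
    "\<forall>j\<in>{1..l}. h (\<mu> j) = f (\<mu> j)" by blast
  have sub: "{1..m} \<subseteq> {1..l}" using m(2) by simp
  have \<mu>': "\<mu> ` {1..m} \<subseteq> ball 0 1" "inj_on \<mu> {1..m}"
    using \<mu> sub by (blast, meson inj_on_subset)
  show False
    by (rule star_form_no_interpolant[OF m(1) p star \<mu>' h(1-3)]) (use h(4) sub in auto)
qed (use m in simp)

section \<open>Integrality of the node counts and conclusion\<close>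

lemma S_set_ge_half: "q \<in> S_set \<Longrightarrow> q $ j \<ge> 1/2"
proof (induction rule: S_set.induct)
  case (scale p c)
  then show ?case using mult_mono[of 1 c "1/2" "p $ j"] by simp
qed auto

text \<open>\<open>\<nat>\<close> contains 0 in Isabelle, so \<open>\<nat> - {0}\<close> stands for
  the positive integers.\<close>

lemma Nats_minus_zero_floor:
  fixes x :: real
  assumes "x \<in> \<nat> - {0}"
  shows "x = real (nat \<lfloor>x\<rfloor>)" "nat \<lfloor>x\<rfloor> \<ge> 1"
  using assms by (auto elim!: Nats_cases)

lemma ge_half_if_ratio_Nats:
  fixes x y :: real
  assumes "x / y \<in> \<nat> - {0}" "y \<ge> 1/2"
  shows "x \<ge> 1/2"
proof -
  have "x / y \<ge> 1"
    using Nats_minus_zero_floor[OF assms(1)] by linarith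
  then have "y \<le> x" using assms(2) by (simp add: le_divide_eq)
  then show ?thesis using assms(2) by linarith
qed

text \<open>Each ratio is an integer at least 1, so the amount added to \<open>m\<close> is a
  natural number and the resulting count is at least \<open>m\<close>.\<close>

lemma sum_ratio_minus_one_mult_eq:
  fixes x :: "'a \<Rightarrow> real"
  assumes "\<And>j. j \<in> I \<Longrightarrow> x j \<in> \<nat> - {0}"
  shows "(\<Sum>j\<in>I. (x j - 1) * real (s j)) = real (\<Sum>j\<in>I. (nat \<lfloor>x j\<rfloor> - 1) * s j)"
  unfolding of_nat_sum
proof (rule sum.cong)
  fix j assume "j \<in> I"
  then have "x j \<in> \<nat> - {0}" by (rule assms)
  from Nats_minus_zero_floor[OF this]
  show "(x j - 1) * real (s j) = real ((nat \<lfloor>x j\<rfloor> - 1) * s j)"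
    by (simp add: of_nat_diff)
qed simp

lemma star_form_l_extremal_real:
  fixes p :: "real ^ 'n"
  assumes "m \<ge> 2" "\<And>j. p $ j \<ge> 1/2" "star_form m p f a \<alpha> \<alpha>0 r" "y = real d"
  shows "\<exists>m'. real m' = real m + y \<and> l_extremal (cellipsoid p) m' f"
  using star_form_l_extremal[OF assms(1) le_add1 assms(2,3), of d] assms(4)
  by (intro exI[of _ "m + d"]) simp

theorem proposition4p15:
  fixes m :: nat
    and p q :: "real ^ 'n"
    and f :: "complex \<Rightarrow> complex ^ 'n"
    and a :: "'n \<Rightarrow> complex"
    and \<alpha> :: "nat \<Rightarrow> 'n \<Rightarrow> complex"
    and \<alpha>0 :: "nat \<Rightarrow> complex"
    and r :: "nat \<Rightarrow> 'n \<Rightarrow> nat"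
    and J :: "'n set"
    and s :: "'n \<Rightarrow> nat"
  assumes m: "m \<ge> 2"
    and p: "\<forall>j. p $ j > 0"
    and f: "star_form m p f a \<alpha> \<alpha>0 r"
    and J: "J = {j. p $ j / q $ j \<notin> \<nat> - {0}}"
    and s: "\<forall>j. s j = card {k \<in> {1..m-1}. r k j = 1}"
  shows "((\<forall>j. p $ j \<ge> 1/2) \<and> q \<in> S_set \<and>
          (\<forall>k\<in>{1..m-1}. \<forall>j\<in>J. \<alpha> k j \<in> ball 0 1 \<and> r k j = 0)
          \<longrightarrow> (\<exists>m' :: nat. real m' = real m + (\<Sum>j\<in>-J. (p $ j / q $ j - 1) * real (s j)) \<and>
                 l_extremal (cellipsoid p) m' f))
       \<and> (q \<in> S_set \<and> (\<forall>j. p $ j / q $ j \<in> \<nat> - {0})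
          \<longrightarrow> (\<exists>m' :: nat. real m' = real m + (real m - 1) *
                   ((\<Sum>j\<in>UNIV. p $ j / q $ j) - real CARD('n)) \<and>
                 l_extremal (cellipsoid p) m' f))"
proof (intro conjI impI; elim conjE)
  assume "\<forall>j. p $ j \<ge> 1/2"
  then have half: "p $ j \<ge> 1/2" for j by blast
  have eq: "(\<Sum>j\<in>-J. (p $ j / q $ j - 1) * real (s j)) =
      real (\<Sum>j\<in>-J. (nat \<lfloor>p $ j / q $ j\<rfloor> - 1) * s j)"
    by (rule sum_ratio_minus_one_mult_eq) (use J in auto)
  show "\<exists>m'. real m' = real m + (\<Sum>j\<in>-J. (p $ j / q $ j - 1) * real (s j)) \<and>
                 l_extremal (cellipsoid p) m' f"
    by (rule star_form_l_extremal_real[OF m half f eq])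
next
  assume q: "q \<in> S_set" and ratio: "\<forall>j. p $ j / q $ j \<in> \<nat> - {0}"
  have half: "p $ j \<ge> 1/2" for j
    using ge_half_if_ratio_Nats[OF _ S_set_ge_half[OF q]] ratio by blast
  \<comment> \<open>Here \<open>m - 1\<close> takes the place of \<open>s j\<close>, and
    \<open>CARD('n)\<close> is absorbed as one unit per coordinate.\<close>
  have "(real m - 1) * ((\<Sum>j\<in>UNIV. p $ j / q $ j) - real CARD('n)) =
      (\<Sum>j\<in>UNIV. (p $ j / q $ j - 1) * real (m - 1))"
    using m by (simp add: sum_distrib_right[symmetric] sum_subtractf of_nat_diff)
  also have "\<dots> = real (\<Sum>j\<in>UNIV. (nat \<lfloor>p $ j / q $ j\<rfloor> - 1) * (m - 1))"
    by (rule sum_ratio_minus_one_mult_eq) (use ratio in blast)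
  finally have eq: "(real m - 1) * ((\<Sum>j\<in>UNIV. p $ j / q $ j) - real CARD('n)) =
      real (\<Sum>j\<in>UNIV. (nat \<lfloor>p $ j / q $ j\<rfloor> - 1) * (m - 1))" .
  show "\<exists>m'. real m' = real m + (real m - 1) *
                   ((\<Sum>j\<in>UNIV. p $ j / q $ j) - real CARD('n)) \<and>
                 l_extremal (cellipsoid p) m' f"
    by (rule star_form_l_extremal_real[OF m half f eq])
qed

end
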